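(* Let $k$ be a field of characteristic different from $2$ containing an element $i$ with $i^2=-1$. Let $X\subset \mathbf{A}^4_k$ be the affine $k$-variety with coordinates $s,t,u,v$ defined by $$s^2 v(v^2-1) - t^2 u(u^2-1) + uv(u^2-v^2) = 0.$$ Then $X$ is $k$-rational, i.e. its function field is purely transcendental over $k$. *)

theory Defs
  imports "HOL-Computational_Algebra.Polynomial" "HOL-Computational_Algebra.Fraction_Field"
begin

text \<open>Polynomials in four variables s,t,u,v over k are represented as
  iterated univariate polynomials k[v][u][t][s] = 'a poly poly poly poly
  (s is the outermost variable, v the innermost one).\<close>

type_synonym 'a mpoly4 = "'a poly poly poly poly"

definition const4 :: "'a::zero \<Rightarrow> 'a mpoly4" where
  "const4 c = [:[:[:[:c:]:]:]:]"

definition var_s :: "'a::comm_ring_1 mpoly4" where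
  "var_s = [:0, 1:]"
definition var_t :: "'a::comm_ring_1 mpoly4" where
  "var_t = [:[:0, 1:]:]"
definition var_u :: "'a::comm_ring_1 mpoly4" where
  "var_u = [:[:[:0, 1:]:]:]"
definition var_v :: "'a::comm_ring_1 mpoly4" where
  "var_v = [:[:[:[:0, 1:]:]:]:]"

definition Fpoly :: "'a::comm_ring_1 mpoly4" where
  "Fpoly = var_s^2 * var_v * (var_v^2 - 1) - var_t^2 * var_u * (var_u^2 - 1)
           + var_u * var_v * (var_u^2 - var_v^2)"

definition eval4 :: "('a::zero \<Rightarrow> 'b::comm_semiring_0) \<Rightarrow> 'a mpoly4 \<Rightarrow> 'b \<Rightarrow> 'b \<Rightarrow> 'b \<Rightarrow> 'b \<Rightarrow> 'b" where
  "eval4 emb p S T U V =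
     poly (map_poly (\<lambda>q3. poly (map_poly (\<lambda>q2. poly (map_poly (\<lambda>q1. poly (map_poly emb q1) V) q2) U) q3) T) p) S"

type_synonym 'a ratfun3 = "'a poly poly poly fract"

definition const3 :: "'a::idom \<Rightarrow> 'a ratfun3" where
  "const3 c = Fract [:[:[:c:]:]:] 1"

text \<open>X = V(F) is k-rational: its function field Frac(k[s,t,u,v]/(F)) is k-isomorphic
  to the purely transcendental extension k(x,y,z).  Concretely: there are
  S,T,U,V in k(x,y,z) such that the k-algebra map k[s,t,u,v] \<rightarrow> k(x,y,z),
  p \<mapsto> p(S,T,U,V), has kernel exactly the ideal (F) (so k[X] embeds), and every
  element of k(x,y,z) is a quotient of images (so the induced map on function
  fields is onto).\<close>
definition k_rational_hypersurface :: "'a::field mpoly4 \<Rightarrow> bool" where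
  "k_rational_hypersurface F \<longleftrightarrow>
     (\<exists>S T U V :: 'a ratfun3.
        (\<forall>p. eval4 const3 p S T U V = 0 \<longleftrightarrow> F dvd p) \<and>
        (\<forall>w :: 'a ratfun3. \<exists>p q. eval4 const3 q S T U V \<noteq> 0 \<and>
              w = eval4 const3 p S T U V / eval4 const3 q S T U V))"

end

theory Submission
  imports Defs "HOL-Computational_Algebra.Polynomial_Factorial" "HOL-Algebra.Algebraic_Closure_Type"
begin

text \<open>
  View $X$ as a conic over $k(u,v)$.  The quaternion algebra of this conic is ramified on the
  $(u,v)$-plane only along the coordinate lines and the line at infinity, and because $-1$ is a
  square it equals $(u,v)$.  Hence the conic is isomorphic to $y^2 + u z^2 + v = 0$, whose total
  space has function field $k(u,y,z)$ since $v$ is determined by $u$, $y$, $z$.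

  The isomorphism is given by explicit formulas.  To see that the kernel of
  $k[s,t,u,v] \to k(x,y,z)$ is not larger than $(F)$, take the generic point of $X$ with
  coordinates in an algebraic closure of $k(t,u,v)$ and move it by the inverse isomorphism to a
  point at which the parametrization can be evaluated: a polynomial in the kernel then vanishes
  at the generic point, hence is divisible by $F$.\<close>

section \<open>Ring homomorphisms and evaluation\<close>

definition is_ring_hom :: "('a::comm_ring_1 \<Rightarrow> 'b::comm_ring_1) \<Rightarrow> bool" where
  "is_ring_hom f \<longleftrightarrow> f 1 = 1 \<and> (\<forall>a b. f (a + b) = f a + f b) \<and> (\<forall>a b. f (a * b) = f a * f b)"

lemma is_ring_hom_simps:
  assumes "is_ring_hom f"
  shows "f 0 = 0" "f 1 = 1" "f (a + b) = f a + f b" "f (a * b) = f a * f b"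
    "f (- a) = - f a" "f (a - b) = f a - f b" "f (a ^ n) = f a ^ n"
proof -
  note h = assms[unfolded is_ring_hom_def]
  show 0: "f 0 = 0"
    using h by (metis add_cancel_right_right)
  show one: "f 1 = 1" and add: "f (a + b) = f a + f b" and mult: "f (a * b) = f a * f b"
    using h by auto
  show minus: "f (- a) = - f a" for a
    using h 0 by (metis add.right_inverse minus_unique)
  show "f (a - b) = f a - f b"
    using h minus by (metis diff_conv_add_uminus)
  show "f (a ^ n) = f a ^ n"
    using h by (induction n) auto
qed

lemma is_ring_hom_comp: "is_ring_hom f \<Longrightarrow> is_ring_hom g \<Longrightarrow> is_ring_hom (\<lambda>x. g (f x))"
  by (simp add: is_ring_hom_def)

lemma is_ring_hom_const_poly: "is_ring_hom (\<lambda>c. [:c:])"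
  by (simp add: is_ring_hom_def one_pCons)

lemma is_ring_hom_Fract: "is_ring_hom (\<lambda>a::'a::idom. Fract a 1)"
  by (simp add: is_ring_hom_def One_fract_def)

lemma is_ring_hom_const3: "is_ring_hom (const3 :: 'a::field \<Rightarrow> 'a ratfun3)"
proof -
  have "is_ring_hom (\<lambda>c::'a. Fract [:[:[:c:]:]:] 1)"
    by (intro is_ring_hom_comp[OF is_ring_hom_const_poly] is_ring_hom_Fract)
  then show ?thesis by (simp add: const3_def[abs_def])
qed

lemma is_ring_hom_to_ac: "is_ring_hom to_ac"
  by (simp add: is_ring_hom_def)

text \<open>A single layer of \<open>eval4\<close>. Facts about four variables then follow by
  applying a univariate lemma four times.\<close>

definition evalp :: "('a::zero \<Rightarrow> 'b::comm_semiring_0) \<Rightarrow> 'b \<Rightarrow> 'a poly \<Rightarrow> 'b" where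
  "evalp f x p = poly (map_poly f p) x"

lemma eval4_eq_evalp: "eval4 f p s t u v = evalp (evalp (evalp (evalp f v) u) t) s p"
  by (simp add: eval4_def evalp_def[abs_def])

lemma evalp_0 [simp]: "evalp f x 0 = 0"
  by (simp add: evalp_def)

lemma evalp_pCons: "f 0 = 0 \<Longrightarrow> evalp f x (pCons a p) = f a + x * evalp f x p"
  by (simp add: evalp_def map_poly_pCons)

lemma is_ring_hom_evalp:
  assumes f: "is_ring_hom f"
  shows "is_ring_hom (evalp f x)"
proof -
  note hom = is_ring_hom_simps[OF f] and step = evalp_pCons[of f x, OF is_ring_hom_simps(1)[OF f]]
  have add: "evalp f x (p + q) = evalp f x p + evalp f x q" for p q
    by (induction p q rule: poly_induct2) (simp_all add: step hom algebra_simps)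
  have smult: "evalp f x (Polynomial.smult c p) = f c * evalp f x p" for c p
    by (induction p) (simp_all add: step hom algebra_simps)
  have "evalp f x (p * q) = evalp f x p * evalp f x q" for p q
    by (induction p) (simp_all add: step hom add smult algebra_simps)
  moreover have "evalp f x 1 = 1"
    by (simp add: one_pCons step hom)
  ultimately show ?thesis
    by (simp add: is_ring_hom_def add)
qed

text \<open>Universal property of the polynomial ring: a homomorphism is determined by its values on
  constants and on the variable. It serves to recognize iterated evaluations as known
  embeddings.\<close>

lemma evalp_unique:
  assumes h: "is_ring_hom h"
  shows "evalp (\<lambda>c. h [:c:]) (h [:0, 1:]) p = h p"
proof (induction p)
  case 0
  then show ?case by (simp add: is_ring_hom_simps[OF h])
next
  case (pCons a p)
  have "pCons a p = [:a:] + [:0, 1:] * p" by simp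
  then have "h (pCons a p) = h [:a:] + h [:0, 1:] * h p"
    using is_ring_hom_simps[OF h] by metis
  then show ?case using pCons by (simp add: evalp_pCons is_ring_hom_simps[OF h])
qed

lemma evalp_closed:
  assumes "\<And>c. f c \<in> A" "f 0 = 0" "x \<in> A" "0 \<in> A"
    "\<And>a b. a \<in> A \<Longrightarrow> b \<in> A \<Longrightarrow> a + b \<in> A" "\<And>a b. a \<in> A \<Longrightarrow> b \<in> A \<Longrightarrow> a * b \<in> A"
  shows "evalp f x p \<in> A"
  using assms by (induction p) (simp_all add: evalp_pCons)

lemma is_ring_hom_eval4: "is_ring_hom f \<Longrightarrow> is_ring_hom (\<lambda>p. eval4 f p s t u v)"
  unfolding eval4_eq_evalp by (intro is_ring_hom_evalp)

lemma eval4_generators: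
  assumes "is_ring_hom f"
  shows "eval4 f (const4 c) s t u v = f c" "eval4 f var_s s t u v = s"
    "eval4 f var_t s t u v = t" "eval4 f var_u s t u v = u" "eval4 f var_v s t u v = v"
  by (simp_all add: eval4_eq_evalp const4_def var_s_def var_t_def var_u_def var_v_def
      evalp_pCons is_ring_hom_simps[OF assms] is_ring_hom_simps[OF is_ring_hom_evalp]
      is_ring_hom_simps[OF is_ring_hom_evalp[OF assms]]
      is_ring_hom_simps[OF is_ring_hom_evalp[OF is_ring_hom_evalp[OF assms]]]
      is_ring_hom_simps[OF is_ring_hom_evalp[OF is_ring_hom_evalp[OF is_ring_hom_evalp[OF assms]]]])

lemma eval4_Fpoly:
  assumes "is_ring_hom f"
  shows "eval4 f Fpoly s t u v
    = s^2 * v * (v^2 - 1) - t^2 * u * (u^2 - 1) + u * v * (u^2 - v^2)"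
  by (simp add: Fpoly_def is_ring_hom_simps[OF is_ring_hom_eval4[OF assms]] eval4_generators[OF assms])

section \<open>Specialization of fractions along a ring homomorphism\<close>

text \<open>A homomorphism \<open>h\<close> that may have a kernel extends only to fractions having
  a denominator outside it, so its extension is encoded as a relation. For a ring homomorphism the
  value does not depend on the fraction chosen.\<close>

definition specializes ::
  "('a::idom \<Rightarrow> 'b::field) \<Rightarrow> 'a fract \<Rightarrow> 'b \<Rightarrow> bool" where
  "specializes h a b \<longleftrightarrow> (\<exists>n d. h d \<noteq> 0 \<and> a = Fract n d \<and> b = h n / h d)"

lemma specializes_Fract_one: "is_ring_hom h \<Longrightarrow> specializes h (Fract a 1) (h a)"
  unfolding specializes_def by (rule exI[of _ a], rule exI[of _ 1]) (simp add: is_ring_hom_simps)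

text \<open>This one direction is all that the kernel computation needs. Its contrapositive also
  transfers nonvanishing from the special point back to the fraction field.\<close>

lemma specializes_zeroD:
  assumes h: "is_ring_hom h" and "specializes h 0 b"
  shows "b = 0"
proof -
  obtain n d where nd: "h d \<noteq> 0" "0 = Fract n d" "b = h n / h d"
    using assms(2) unfolding specializes_def by auto
  \<comment> \<open>\<open>Fract n 0\<close> is 0 for every \<open>n\<close>, so
    \<open>n = 0\<close> can be concluded only once \<open>d\<close> is known to be nonzero.\<close>
  then have "d \<noteq> 0" using is_ring_hom_simps(1)[OF h] by auto
  then have "n = 0" using nd(2) by (simp add: Zero_fract_def eq_fract)
  then show ?thesis using nd is_ring_hom_simps(1)[OF h] by simp
qed

lemma specializes_add:
  assumes h: "is_ring_hom h" and "specializes h a b" "specializes h a' b'"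
  shows "specializes h (a + a') (b + b')"
proof -
  obtain n d n' d' where nd: "h d \<noteq> 0" "a = Fract n d" "b = h n / h d"
      "h d' \<noteq> 0" "a' = Fract n' d'" "b' = h n' / h d'"
    using assms(2,3) unfolding specializes_def by auto
  have "d \<noteq> 0" "d' \<noteq> 0" using nd is_ring_hom_simps(1)[OF h] by auto
  then show ?thesis
    unfolding specializes_def using nd
    by (intro exI[of _ "n * d' + n' * d"] exI[of _ "d * d'"]) (auto simp: is_ring_hom_simps[OF h] field_simps)
qed

lemma specializes_mult:
  assumes h: "is_ring_hom h" and "specializes h a b" "specializes h a' b'"
  shows "specializes h (a * a') (b * b')"
proof -
  obtain n d n' d' where nd: "h d \<noteq> 0" "a = Fract n d" "b = h n / h d"
      "h d' \<noteq> 0" "a' = Fract n' d'" "b' = h n' / h d'"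
    using assms(2,3) unfolding specializes_def by auto
  then show ?thesis
    unfolding specializes_def
    by (intro exI[of _ "n * n'"] exI[of _ "d * d'"]) (auto simp: is_ring_hom_simps[OF h])
qed

lemma specializes_inverse:
  assumes h: "is_ring_hom h" and "specializes h a b" "b \<noteq> 0"
  shows "specializes h (inverse a) (inverse b)"
proof -
  obtain n d where nd: "h d \<noteq> 0" "a = Fract n d" "b = h n / h d"
    using assms(2) unfolding specializes_def by auto
  then show ?thesis
    unfolding specializes_def using assms(3)
    by (intro exI[of _ d] exI[of _ n]) auto
qed

lemma specializes_divide:
  assumes "is_ring_hom h" "specializes h a b" "specializes h a' b'" "b' \<noteq> 0"
  shows "specializes h (a / a') (b / b')"
  using specializes_mult[OF assms(1,2) specializes_inverse[OF assms(1,3,4)]]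
  by (simp add: divide_inverse)

lemma specializes_uminus:
  assumes h: "is_ring_hom h" and "specializes h a b"
  shows "specializes h (- a) (- b)"
proof -
  obtain n d where nd: "h d \<noteq> 0" "a = Fract n d" "b = h n / h d"
    using assms(2) unfolding specializes_def by auto
  then show ?thesis
    unfolding specializes_def
    by (intro exI[of _ "- n"] exI[of _ d]) (auto simp: is_ring_hom_simps[OF h])
qed

lemma specializes_diff:
  assumes "is_ring_hom h" "specializes h a b" "specializes h a' b'"
  shows "specializes h (a - a') (b - b')"
  using specializes_add[OF assms(1,2) specializes_uminus[OF assms(1,3)]] by simp

lemma specializes_zero: "is_ring_hom h \<Longrightarrow> specializes h 0 0"
  using specializes_Fract_one[of h 0] by (simp add: is_ring_hom_simps Zero_fract_def)

lemma specializes_one: "is_ring_hom h \<Longrightarrow> specializes h 1 1"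
  using specializes_Fract_one[of h 1] by (simp add: is_ring_hom_simps One_fract_def)

lemma specializes_power2:
  "is_ring_hom h \<Longrightarrow> specializes h a b \<Longrightarrow> specializes h (a^2) (b^2)"
  by (simp add: power2_eq_square specializes_mult)

lemma specializes_evalp:
  assumes h: "is_ring_hom h" and fg: "\<And>c. specializes h (f c) (g c)" "f 0 = 0" "g 0 = 0"
    and xy: "specializes h x y"
  shows "specializes h (evalp f x p) (evalp g y p)"
proof (induction p)
  case 0
  then show ?case using specializes_zero[OF h] by simp
next
  case (pCons a p)
  then show ?case
    using fg xy by (simp add: evalp_pCons specializes_add[OF h] specializes_mult[OF h])
qed

lemma specializes_eval4:
  assumes h: "is_ring_hom h" and fg: "\<And>c. specializes h (f c) (g c)" "f 0 = 0" "g 0 = 0"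
    and "specializes h s s'" "specializes h t t'" "specializes h u u'" "specializes h v v'"
  shows "specializes h (eval4 f p s t u v) (eval4 g p s' t' u' v')"
  unfolding eval4_eq_evalp by (intro specializes_evalp) (use assms in auto)

text \<open>If \<pi> x = F q, the prime \<pi> divides q, and cancelling it leaves F dividing x. This
  removes the powers of the leading coefficient that pseudo-division introduces.\<close>

lemma dvd_cancel_prime_power:
  fixes F p :: "'a::idom"
  assumes pi: "prime_elem \<pi>" and nd: "\<not> \<pi> dvd F" and "F dvd \<pi> ^ n * p"
  shows "F dvd p"
  using assms(3)
proof (induction n)
  case (Suc n)
  then obtain q where q: "\<pi> * (\<pi> ^ n * p) = F * q"
    unfolding power_Suc mult.assoc by (elim dvdE)
  then have "\<pi> dvd F * q" by (metis dvd_triv_left)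
  then obtain r where r: "q = \<pi> * r"
    using pi nd by (auto dest: prime_elem_dvd_multD)
  have "\<pi> \<noteq> 0" using pi by auto
  then have "\<pi> ^ n * p = F * r" using q r by (metis mult.left_commute mult_cancel_left)
  then show ?case using Suc.IH by simp
qed simp

section \<open>The generic point of the hypersurface\<close>

text \<open>In the notation $F = A s^2 - (B t^2 - C)$ these are $A$ and $B t^2 - C$, as elements of $k[v][u][t]$.\<close>

abbreviation vA :: "'a::field poly poly poly" where
  "vA \<equiv> [:[:[:0, 1:] * ([:0, 1:]^2 - 1):]:]"
abbreviation tBC :: "'a::field poly poly poly" where
  "tBC \<equiv> [:0, 1:]^2 * [:[:0, 1:] * ([:0, 1:]^2 - 1):]
           - [:[:0, 1:] * [:[:0, 1:]:] * ([:0, 1:]^2 - [:[:0, 1:]^2:]):]"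

lemma Fpoly_eq: "Fpoly = [: - tBC, 0, vA :]"
  by (simp add: Fpoly_def var_s_def var_t_def var_u_def var_v_def power2_eq_square one_pCons)

lemma tBC_eq:
  "tBC = [: - ([:0, 1:] * [:[:0, 1:]:] * ([:0, 1:]^2 - [:[:0, 1:]^2:])), 0, [:0, -1, 0, 1:] :]"
  by (simp add: power2_eq_square one_pCons)

lemma vA_neq_0: "(vA :: 'a::field poly poly poly) \<noteq> 0"
  by (simp add: power2_eq_square one_pCons)

lemma degree_Fpoly: "Polynomial.degree (Fpoly :: 'a::field mpoly4) = 2"
  unfolding Fpoly_eq using vA_neq_0[where 'a='a] by (auto simp: numeral_2_eq_2)

lemma Fpoly_not_dvd:
  assumes "(p :: 'a::field mpoly4) \<noteq> 0" "Polynomial.degree p < 2"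
  shows "\<not> Fpoly dvd p"
  using assms dvd_imp_degree_le[of Fpoly p] by (auto simp: degree_Fpoly)

text \<open>Compare degrees in $t$, then the parity of the degrees in $u$ of the leading coefficients.\<close>

lemma norm_form_anisotropic:
  fixes a b :: "'a::field poly poly poly"
  assumes eq: "a^2 * vA = b^2 * tBC"
  shows "a = 0 \<and> b = 0"
proof (cases "b = 0")
  case True
  then show ?thesis using eq vA_neq_0 by auto
next
  case False
  have deg: "Polynomial.degree (tBC :: 'a poly poly poly) = 2"
    and lc: "Polynomial.lead_coeff (tBC :: 'a poly poly poly) = [:0, -1, 0, 1:]"
    unfolding tBC_eq by (simp_all add: numeral_2_eq_2)
  have nz: "a^2 * vA \<noteq> 0" unfolding eq using False deg by auto
  then have a: "a \<noteq> 0" by auto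
  have "Polynomial.lead_coeff (a^2 * vA) = Polynomial.lead_coeff (b^2 * tBC)" using eq by simp
  then have "(Polynomial.lead_coeff a)^2 * [:[:0, 1:] * ([:0, 1:]^2 - 1):]
      = (Polynomial.lead_coeff b)^2 * [:0, -1, 0, 1:]"
    by (simp only: lead_coeff_mult lead_coeff_power lc) simp
  moreover have "Polynomial.degree ((Polynomial.lead_coeff a)^2 * [:[:0, 1:] * ([:0, 1:]^2 - 1):])
      = 2 * Polynomial.degree (Polynomial.lead_coeff a)"
    using a by (subst degree_mult_eq) (auto simp: degree_mult_eq power2_eq_square one_pCons)
  moreover have "Polynomial.degree ((Polynomial.lead_coeff b)^2 * [:0, -1, 0, 1:])
      = 2 * Polynomial.degree (Polynomial.lead_coeff b) + 3"
    using False by (subst degree_mult_eq) (auto simp: degree_power_eq)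
  ultimately have "2 * Polynomial.degree (Polynomial.lead_coeff a)
      = 2 * Polynomial.degree (Polynomial.lead_coeff b) + 3"
    by metis
  then show ?thesis by presburger
qed

lemma prime_elem_linear_v: "prime_elem ([:[:[:[:a, 1:]:]:]:] :: 'a::field mpoly4)"
  by (simp add: prime_elem_const_poly_iff prime_elem_linear_field_poly)

text \<open>A factor in k[v] divides every coefficient of F over k[v], but the monomial t^2 u^3
  occurs with coefficient -1.\<close>

lemma linear_v_not_dvd_Fpoly: "\<not> ([:[:[:[:a, 1:]:]:]:] :: 'a::field mpoly4) dvd Fpoly"
proof
  assume "([:[:[:[:a, 1:]:]:]:] :: 'a mpoly4) dvd Fpoly"
  then have "[:[:[:a, 1:]:]:] dvd - (tBC :: 'a poly poly poly)"
    unfolding const_poly_dvd_iff Fpoly_eq by (metis coeff_pCons_0)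
  then have "[:[:[:a, 1:]:]:] dvd (tBC :: 'a poly poly poly)"
    by (simp only: dvd_minus_iff)
  then have "[:[:a, 1:]:] dvd Polynomial.coeff (tBC :: 'a poly poly poly) 2"
    unfolding const_poly_dvd_iff by blast
  then have "[:[:a, 1:]:] dvd [:0, -1, 0, 1 :: 'a poly:]"
    unfolding tBC_eq by (simp add: numeral_2_eq_2)
  then have "[:a, 1:] dvd Polynomial.coeff [:0, -1, 0, 1 :: 'a poly:] 3"
    unfolding const_poly_dvd_iff by blast
  then show False
    by (simp add: numeral_3_eq_3 is_unit_poly_iff)
qed

text \<open>Keep t, u, v as independent variables and let s be a square root of
  \<open>tBC / vA\<close>. A polynomial vanishing there has a pseudo-remainder r0 + r1 s modulo F
  that also vanishes, and anisotropy of the norm form forces it to be 0.\<close>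

lemma generic_point_exists:
  "\<exists>s t u v :: 'a::field ratfun3 alg_closure. \<forall>p.
     eval4 (\<lambda>c. to_ac (const3 c)) p s t u v = 0 \<longleftrightarrow> Fpoly dvd p"
proof -
  define \<iota> :: "'a poly poly poly \<Rightarrow> 'a ratfun3 alg_closure" where "\<iota> q = to_ac (Fract q 1)" for q
  have hom: "is_ring_hom \<iota>"
    unfolding \<iota>_def[abs_def] by (intro is_ring_hom_comp[OF is_ring_hom_Fract] is_ring_hom_to_ac)
  note hs = is_ring_hom_simps[OF hom]
  have inj: "\<iota> a = \<iota> b \<longleftrightarrow> a = b" for a b
    by (simp add: \<iota>_def eq_fract)
  obtain s where s: "s ^ 2 = \<iota> tBC / \<iota> vA"
    using nth_root_exists[of 2 "\<iota> tBC / \<iota> vA"] by auto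
  have A0: "\<iota> vA \<noteq> 0"
    using inj[of vA 0] vA_neq_0 hs(1) by metis
  let ?t = "\<iota> [:0, 1:]" and ?u = "\<iota> [:[:0, 1:]:]" and ?v = "\<iota> [:[:[:0, 1:]:]:]"
  have hom1: "is_ring_hom (\<lambda>q. \<iota> [:q:])" and hom2: "is_ring_hom (\<lambda>q. \<iota> [:[:q:]:])"
    by (intro is_ring_hom_comp[OF is_ring_hom_const_poly] hom)+
  \<comment> \<open>By uniqueness the three inner evaluations collapse to \<iota>, so only the
    substitution for s remains.\<close>
  have "evalp (\<lambda>c. to_ac (const3 c)) ?v = (\<lambda>q. \<iota> [:[:q:]:])"
    using evalp_unique[OF hom2] by (simp add: fun_eq_iff \<iota>_def const3_def)
  moreover have "evalp (\<lambda>q. \<iota> [:[:q:]:]) ?u = (\<lambda>q. \<iota> [:q:])"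
    using evalp_unique[OF hom1] by (simp add: fun_eq_iff)
  moreover have "evalp (\<lambda>q. \<iota> [:q:]) ?t = \<iota>"
    using evalp_unique[OF hom] by (simp add: fun_eq_iff)
  ultimately have eval: "eval4 (\<lambda>c. to_ac (const3 c)) p s ?t ?u ?v = evalp \<iota> s p" for p
    by (simp add: eval4_eq_evalp)
  note ev = is_ring_hom_simps[OF is_ring_hom_evalp[OF hom, of s]]
  have F0: "evalp \<iota> s Fpoly = 0"
  proof -
    have "evalp \<iota> s Fpoly = - \<iota> tBC + s^2 * \<iota> vA"
      unfolding Fpoly_eq
      by (simp only: evalp_pCons[of \<iota>, OF hs(1)] hs(1,5) evalp_0) (simp add: power2_eq_square)
    then show ?thesis using s A0 by simp
  qed
  have "Fpoly dvd p" if p0: "evalp \<iota> s p = 0" for p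
  proof -
    \<comment> \<open>The leading coefficient v(v^2-1) of F in s is not a unit, hence
      pseudo-division.\<close>
    obtain q r where qr: "pseudo_divmod p Fpoly = (q, r)" by fastforce
    have Fnz: "(Fpoly :: 'a mpoly4) \<noteq> 0"
      using degree_Fpoly[where 'a='a] by auto
    have Flc: "Polynomial.coeff (Fpoly :: 'a mpoly4) 2 = vA"
      unfolding Fpoly_eq by (simp add: numeral_2_eq_2)
    \<comment> \<open>The exponent in \<open>pseudo_divmod\<close>; by truncated subtraction it is 0
      exactly when p has degree less than 2 in s.\<close>
    define n where "n = Suc (Polynomial.degree p) - 2"
    have div: "Polynomial.smult (vA ^ n) p = Fpoly * q + r"
      and deg: "r = 0 \<or> Polynomial.degree r < 2"
      using pseudo_divmod[OF Fnz qr] unfolding degree_Fpoly Flc n_def by auto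
    obtain r0 r1 where r: "r = [:r0, r1:]"
    proof -
      have "r = [:Polynomial.coeff r 0, Polynomial.coeff r 1:]"
        using deg by (auto intro!: poly_eqI simp: coeff_pCons coeff_eq_0 split: nat.splits)
      then show ?thesis using that by blast
    qed
    have "evalp \<iota> s (Polynomial.smult (vA ^ n) p) = 0"
      using ev(4)[of "[:vA ^ n:]" p] p0 by simp
    then have "evalp \<iota> s r = 0"
      unfolding div using ev F0 by simp
    then have "\<iota> r0 = - s * \<iota> r1"
      unfolding r by (simp add: evalp_pCons hs eq_neg_iff_add_eq_0)
    \<comment> \<open>Squaring eliminates s and gives an equation over k[v][u][t], where \<iota> is
      injective.\<close>
    then have "\<iota> r0 ^ 2 * \<iota> vA = \<iota> r1 ^ 2 * \<iota> tBC"
      using s A0 by (simp add: power_mult_distrib)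
    then have "r0^2 * vA = r1^2 * tBC"
      unfolding hs(4,7)[symmetric] inj .
    then have "r = 0"
      using norm_form_anisotropic r by fastforce
    then have dvd: "Fpoly dvd [:vA:] ^ n * p"
      using div by (simp add: poly_const_pow)
    \<comment> \<open>v(v+1)(v-1) is a product of primes not dividing F, so each power can be
      cancelled in turn.\<close>
    have "[:vA:]
        = ([:[:[:[:0, 1:]:]:]:] * ([:[:[:[:1, 1:]:]:]:] * [:[:[:[:- 1, 1:]:]:]:]) :: 'a mpoly4)"
      by (simp add: power2_eq_square one_pCons)
    then have "[:vA:] ^ n * p
        = [:[:[:[:0, 1:]:]:]:] ^ n * ([:[:[:[:1, 1:]:]:]:] ^ n * ([:[:[:[:- 1, 1:]:]:]:] ^ n * p))"
      by (simp only: power_mult_distrib mult.assoc)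
    then show ?thesis
      using dvd by (metis dvd_cancel_prime_power prime_elem_linear_v linear_v_not_dvd_Fpoly)
  qed
  moreover have "evalp \<iota> s p = 0" if "Fpoly dvd p" for p
    using that F0 by (elim dvdE) (simp add: ev)
  ultimately show ?thesis
    unfolding eval[symmetric] by blast
qed

section \<open>The isomorphism of conics\<close>

text \<open>
  Over $k(u,v)$ the vectors
  $e_1 = (uv+ju+jv+1,\ (1-j)u(1+v),\ (1-j)v(u-1))$,
  $e_2 = ((1+j)(u+v),\ (1-j)u(1+v),\ u-juv+jv-v^2)$ and
  $e_3 = ((1+j)(u+v),\ v-ju-juv+u^2,\ (1+j)v(1-u))$
  form an orthogonal basis for the quadratic form $uvP^2+vR^2+uS^2$, with values
  $uv(u^2-1)(v^2-1)$, $-u(v^2-1)(u^2-v^2)$ and $v(u^2-1)(u^2-v^2)$.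
  The linear forms below are, up to the factor $uv$, the products of $e_1,e_2,e_3$ with the point
  $(P,R,S) = (y, uz, v)$; the functions after them are the coordinates of
  $(u^2-v^2)e_1 - t(u^2-1)e_2 + s(v^2-1)e_3$, which recovers this point up to a scalar.\<close>

definition conic_form1 :: "'b::comm_ring_1 \<Rightarrow> 'b \<Rightarrow> 'b \<Rightarrow> 'b \<Rightarrow> 'b \<Rightarrow> 'b" where
  "conic_form1 j u v y z = (u*v + j*u + j*v + 1)*y + (1-j)*u*(1+v)*z + (1-j)*v*(u-1)"
definition conic_form2 :: "'b::comm_ring_1 \<Rightarrow> 'b \<Rightarrow> 'b \<Rightarrow> 'b \<Rightarrow> 'b \<Rightarrow> 'b" where
  "conic_form2 j u v y z = (1+j)*(u+v)*y + (1-j)*u*(1+v)*z + (u - j*u*v + j*v - v^2)"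
definition conic_form3 :: "'b::comm_ring_1 \<Rightarrow> 'b \<Rightarrow> 'b \<Rightarrow> 'b \<Rightarrow> 'b \<Rightarrow> 'b" where
  "conic_form3 j u v y z = (1+j)*(u+v)*y + (v - j*u - j*u*v + u^2)*z + (1+j)*v*(1-u)"

definition inv_coord1 :: "'b::comm_ring_1 \<Rightarrow> 'b \<Rightarrow> 'b \<Rightarrow> 'b \<Rightarrow> 'b \<Rightarrow> 'b" where
  "inv_coord1 j s t u v =
    (u^2-v^2)*(u*v + j*u + j*v + 1) - t*(u^2-1)*((1+j)*(u+v)) + s*(v^2-1)*((1+j)*(u+v))"
definition inv_coord2 :: "'b::comm_ring_1 \<Rightarrow> 'b \<Rightarrow> 'b \<Rightarrow> 'b \<Rightarrow> 'b \<Rightarrow> 'b" where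
  "inv_coord2 j s t u v =
    (u^2-v^2)*((1-j)*u*(1+v)) - t*(u^2-1)*((1-j)*u*(1+v))
    + s*(v^2-1)*(v - j*u - j*u*v + u^2)"
definition inv_coord3 :: "'b::comm_ring_1 \<Rightarrow> 'b \<Rightarrow> 'b \<Rightarrow> 'b \<Rightarrow> 'b \<Rightarrow> 'b" where
  "inv_coord3 j s t u v =
    (u^2-v^2)*((1-j)*v*(u-1)) - t*(u^2-1)*(u - j*u*v + j*v - v^2)
    + s*(v^2-1)*((1+j)*v*(1-u))"

text \<open>The orthogonal expansion of x = (y, uz, v), namely the sum of <x,e_i>/<e_i,e_i> e_i,
  coordinate by coordinate and with denominators cleared.\<close>

lemma conic_forms_expansion:
  fixes j :: "'b::comm_ring_1"
  assumes "j^2 = -1"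
  shows "(u^2-v^2) * conic_form1 j u v y z * (u*v + j*u + j*v + 1)
      - v*(u^2-1) * conic_form2 j u v y z * ((1+j)*(u+v))
      + u*(v^2-1) * conic_form3 j u v y z * ((1+j)*(u+v))
    = (u^2-1)*(v^2-1)*(u^2-v^2) * y" (is ?A)
  and "(u^2-v^2) * conic_form1 j u v y z * ((1-j)*u*(1+v))
      - v*(u^2-1) * conic_form2 j u v y z * ((1-j)*u*(1+v))
      + u*(v^2-1) * conic_form3 j u v y z * (v - j*u - j*u*v + u^2)
    = (u^2-1)*(v^2-1)*(u^2-v^2) * (u*z)" (is ?B)
  and "(u^2-v^2) * conic_form1 j u v y z * ((1-j)*v*(u-1))
      - v*(u^2-1) * conic_form2 j u v y z * (u - j*u*v + j*v - v^2)
      + u*(v^2-1) * conic_form3 j u v y z * ((1+j)*v*(1-u))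
    = (u^2-1)*(v^2-1)*(u^2-v^2) * v" (is ?C)
proof -
  \<comment> \<open>Both shapes of a repeated factor j are needed to reduce the expanded products to
    degree at most 1 in j.\<close>
  have jj: "j*j = -1" "\<And>x. j*(j*x) = -x"
    using assms by (simp_all add: power2_eq_square flip: mult.assoc)
  show ?A ?B ?C
    unfolding conic_form1_def conic_form2_def conic_form3_def
    by (simp_all add: algebra_simps power2_eq_square jj)
qed

text \<open>Pairing the orthogonal expansion of x with x itself gives the sum of
  <x,e_i>^2/<e_i,e_i>, which must equal the value of the form at x, that is uv(y^2 + uz^2 +
  v).\<close>

lemma conic_forms_relation:
  fixes j :: "'b::comm_ring_1"
  assumes "j^2 = -1"
  shows "u*(v^2-1) * (conic_form3 j u v y z)^2 - v*(u^2-1) * (conic_form2 j u v y z)^2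
      + (u^2-v^2) * (conic_form1 j u v y z)^2
    = (u^2-1)*(v^2-1)*(u^2-v^2) * (y^2 + u*z^2 + v)" (is "_ = ?K * _")
proof -
  \<comment> \<open>One factor of each square stays opaque; only the other is expanded, as a linear
    form in y and z.\<close>
  define a b c where "a = conic_form1 j u v y z" and "b = conic_form2 j u v y z"
    and "c = conic_form3 j u v y z"
  have "u*(v^2-1)*c^2 - v*(u^2-1)*b^2 + (u^2-v^2)*a^2
      = u*(v^2-1)*c * conic_form3 j u v y z - v*(u^2-1)*b * conic_form2 j u v y z
        + (u^2-v^2)*a * conic_form1 j u v y z"
    by (simp add: a_def b_def c_def power2_eq_square mult.assoc)
  also have "\<dots> = y*(?K*y) + z*(?K*(u*z)) + ?K*v"
    unfolding conic_forms_expansion[OF assms, of u v y z, folded a_def b_def c_def, symmetric]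
    unfolding conic_form1_def conic_form2_def conic_form3_def by (simp add: algebra_simps)
  also have "\<dots> = ?K * (y^2 + u*z^2 + v)"
    by (simp add: algebra_simps power2_eq_square)
  finally show ?thesis by (simp add: a_def b_def c_def)
qed

text \<open>By orthogonality, pairing w = (u^2-v^2)e_1 - t(u^2-1)e_2 + s(v^2-1)e_3 with e_i leaves
  the i-th coefficient times the value of the form at e_i.\<close>

lemma inv_coords_products:
  fixes j :: "'b::comm_ring_1"
  assumes "j^2 = -1"
  shows "u*v * inv_coord1 j s t u v * (u*v + j*u + j*v + 1)
      + v * inv_coord2 j s t u v * ((1-j)*u*(1+v)) + u * inv_coord3 j s t u v * ((1-j)*v*(u-1))
    = u*v * ((u^2-1)*(v^2-1)*(u^2-v^2))" (is ?A)
  and "u*v * inv_coord1 j s t u v * ((1+j)*(u+v))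
      + v * inv_coord2 j s t u v * ((1-j)*u*(1+v))
      + u * inv_coord3 j s t u v * (u - j*u*v + j*v - v^2)
    = t*u * ((u^2-1)*(v^2-1)*(u^2-v^2))" (is ?B)
  and "u*v * inv_coord1 j s t u v * ((1+j)*(u+v))
      + v * inv_coord2 j s t u v * (v - j*u - j*u*v + u^2)
      + u * inv_coord3 j s t u v * ((1+j)*v*(1-u))
    = s*v * ((u^2-1)*(v^2-1)*(u^2-v^2))" (is ?C)
proof -
  have jj: "j*j = -1" "\<And>x. j*(j*x) = -x"
    using assms by (simp_all add: power2_eq_square flip: mult.assoc)
  show ?A ?B ?C
    unfolding inv_coord1_def inv_coord2_def inv_coord3_def
    by (simp_all add: algebra_simps power2_eq_square jj)
qed

text \<open>The value of the diagonal form at w is the equation of X up to the factor K, so w is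
  isotropic at points of X.\<close>

lemma inv_coords_relation:
  fixes j :: "'b::comm_ring_1"
  assumes "j^2 = -1"
  shows "u*v * (inv_coord1 j s t u v)^2 + v * (inv_coord2 j s t u v)^2
      + u * (inv_coord3 j s t u v)^2
    = (u^2-1)*(v^2-1)*(u^2-v^2) * (s^2*v*(v^2-1) - t^2*u*(u^2-1) + u*v*(u^2-v^2))"
    (is "_ = ?K * _")
proof -
  define a b c where "a = inv_coord1 j s t u v" and "b = inv_coord2 j s t u v"
    and "c = inv_coord3 j s t u v"
  have "u*v*a^2 + v*b^2 + u*c^2
      = u*v*a * inv_coord1 j s t u v + v*b * inv_coord2 j s t u v + u*c * inv_coord3 j s t u v"
    by (simp add: a_def b_def c_def power2_eq_square mult.assoc)
  also have "\<dots> = (u^2-v^2)*(u*v*?K) - t*(u^2-1)*(t*u*?K) + s*(v^2-1)*(s*v*?K)"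
    unfolding inv_coords_products[OF assms, of u v s t, folded a_def b_def c_def, symmetric]
    unfolding inv_coord1_def inv_coord2_def inv_coord3_def by (simp add: algebra_simps)
  also have "\<dots> = ?K * (s^2*v*(v^2-1) - t^2*u*(u^2-1) + u*v*(u^2-v^2))"
    by (simp add: algebra_simps power2_eq_square)
  finally show ?thesis by (simp add: a_def b_def c_def)
qed

text \<open>The choice of s and t makes the coefficients of the expansion of x proportional to those
  of w: K x = l_1 w, where l_1 is the first linear form. This is what the last three conclusions
  state.\<close>

lemma parametrization:
  fixes j :: "'b::field"
  assumes j: "j^2 = -1" and v: "v = - (y^2 + u*z^2)" and nz: "conic_form1 j u v y z \<noteq> 0"
  defines "s \<equiv> u * conic_form3 j u v y z / conic_form1 j u v y z"
    and "t \<equiv> v * conic_form2 j u v y z / conic_form1 j u v y z"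
  shows "s^2 * v * (v^2 - 1) - t^2 * u * (u^2 - 1) + u * v * (u^2 - v^2) = 0"
    and "conic_form1 j u v y z * inv_coord1 j s t u v = (u^2-1)*(v^2-1)*(u^2-v^2)*y"
    and "conic_form1 j u v y z * inv_coord2 j s t u v = (u^2-1)*(v^2-1)*(u^2-v^2)*(u*z)"
    and "conic_form1 j u v y z * inv_coord3 j s t u v = (u^2-1)*(v^2-1)*(u^2-v^2)*v"
proof -
  define a b c where "a = conic_form1 j u v y z" and "b = conic_form2 j u v y z"
    and "c = conic_form3 j u v y z"
  have a: "a \<noteq> 0" and st: "s = u * c / a" "t = v * b / a"
    using nz by (simp_all add: a_def b_def c_def s_def t_def)
  have v0: "y^2 + u*z^2 + v = 0" using v by simp
  have sa: "s * a = u * c" and ta: "t * a = v * b" using a st by auto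
  have "u*(v^2-1)*c^2 - v*(u^2-1)*b^2 + (u^2-v^2)*a^2 = 0"
    using conic_forms_relation[OF j, of u v y z] unfolding v0 a_def b_def c_def by simp
  moreover have "a^2 * (s^2 * v * (v^2 - 1) - t^2 * u * (u^2 - 1) + u * v * (u^2 - v^2))
     = v * (v^2-1) * (s*a)^2 - u * (u^2-1) * (t*a)^2 + u*v*(u^2-v^2)*a^2"
    by (simp add: algebra_simps power_mult_distrib)
  moreover have "\<dots> = u*v*(u*(v^2-1)*c^2 - v*(u^2-1)*b^2 + (u^2-v^2)*a^2)"
    unfolding sa ta by (simp add: algebra_simps power2_eq_square)
  ultimately show "s^2 * v * (v^2 - 1) - t^2 * u * (u^2 - 1) + u * v * (u^2 - v^2) = 0"
    using a by simp
  note e = conic_forms_expansion[OF j, of u v y z, folded a_def b_def c_def, symmetric]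
  have lin: "a * ((u^2-v^2)*p - t*(u^2-1)*q + s*(v^2-1)*r)
     = (u^2-v^2)*a*p - v*(u^2-1)*b*q + u*(v^2-1)*c*r" for p q r
  proof -
    have "a * ((u^2-v^2)*p - t*(u^2-1)*q + s*(v^2-1)*r)
      = (u^2-v^2)*a*p - (u^2-1)*(t*a)*q + (v^2-1)*(s*a)*r"
      by (simp add: algebra_simps)
    then show ?thesis unfolding sa ta by (simp add: algebra_simps)
  qed
  show "conic_form1 j u v y z * inv_coord1 j s t u v = (u^2-1)*(v^2-1)*(u^2-v^2)*y"
    "conic_form1 j u v y z * inv_coord2 j s t u v = (u^2-1)*(v^2-1)*(u^2-v^2)*(u*z)"
    "conic_form1 j u v y z * inv_coord3 j s t u v = (u^2-1)*(v^2-1)*(u^2-v^2)*v"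
    unfolding e
    unfolding inv_coord1_def inv_coord2_def inv_coord3_def lin a_def[symmetric] by simp_all
qed

text \<open>On X the vector w is isotropic; rescaling it by v / \<open>inv_coord3\<close> makes its
  third coordinate v, and y, z are read off from the other two. The linear forms at this point are
  then known from the products of w with the e_i.\<close>

lemma parametrization_preimage:
  fixes j :: "'b::field"
  assumes j: "j^2 = -1"
    and F: "s^2 * v * (v^2 - 1) - t^2 * u * (u^2 - 1) + u * v * (u^2 - v^2) = 0"
    and nz: "inv_coord3 j s t u v \<noteq> 0" "u \<noteq> 0" "v \<noteq> 0" "(u^2-1)*(v^2-1)*(u^2-v^2) \<noteq> 0"
  defines "y \<equiv> v * inv_coord1 j s t u v / inv_coord3 j s t u v"
    and "z \<equiv> v * inv_coord2 j s t u v / (u * inv_coord3 j s t u v)"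
  shows "v = - (y^2 + u*z^2)" "conic_form1 j u v y z \<noteq> 0"
    "s = u * conic_form3 j u v y z / conic_form1 j u v y z"
    "t = v * conic_form2 j u v y z / conic_form1 j u v y z"
proof -
  define P R S K where "P = inv_coord1 j s t u v" and "R = inv_coord2 j s t u v"
    and "S = inv_coord3 j s t u v"
    and "K = (u^2-1)*(v^2-1)*(u^2-v^2)"
  have S: "S \<noteq> 0" and K: "K \<noteq> 0" and y: "y = v * P / S" and z: "z = v * R / (u * S)"
    using nz by (simp_all add: P_def R_def S_def K_def y_def z_def)
  have "u*v*P^2 + v*R^2 + u*S^2 = 0"
    using inv_coords_relation[OF j, of u v s t] F by (simp add: P_def R_def S_def)
  moreover have "u * S^2 * (y^2 + u*z^2 + v) = v * (u*v*P^2 + v*R^2 + u*S^2)"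
    using S nz(2) unfolding y z by (simp add: field_simps power2_eq_square)
  ultimately have "y^2 + u*z^2 + v = 0" using S nz(2) by simp
  then show "v = - (y^2 + u*z^2)" by (metis add.commute eq_neg_iff_add_eq_0)
  \<comment> \<open>An affine form in y and z is the pairing of w with (p,q,r), divided by
    \<open>u * S\<close>.\<close>
  have lin: "p*y + q*z + r = (u*v*P*p + v*R*q + u*S*r) / (u * S)" for p q r
    using S nz(2) unfolding y z by (simp add: field_simps)
  note e = inv_coords_products[OF j, of u v s t, folded P_def R_def S_def K_def]
  have l: "conic_form1 j u v y z = u*v*K / (u*S)"
    "conic_form2 j u v y z = t*u*K / (u*S)"
    "conic_form3 j u v y z = s*v*K / (u*S)"
    unfolding conic_form1_def conic_form2_def conic_form3_def lin e by simp_all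
  show "conic_form1 j u v y z \<noteq> 0"
    "s = u * conic_form3 j u v y z / conic_form1 j u v y z"
    "t = v * conic_form2 j u v y z / conic_form1 j u v y z"
    unfolding l using S K nz by (simp_all add: field_simps)
qed

section \<open>Rationality of the hypersurface\<close>

lemma specializes_conic_forms:
  assumes h: "is_ring_hom h" and sp: "specializes h j j'" "specializes h u u'" "specializes h v v'"
     "specializes h y y'" "specializes h z z'"
  shows "specializes h (conic_form1 j u v y z) (conic_form1 j' u' v' y' z')"
    "specializes h (conic_form2 j u v y z) (conic_form2 j' u' v' y' z')"
    "specializes h (conic_form3 j u v y z) (conic_form3 j' u' v' y' z')"
  unfolding conic_form1_def conic_form2_def conic_form3_def
  by (intro specializes_add specializes_mult specializes_diff specializes_power2
      specializes_one h sp)+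

lemma ring_hom_inv_coord:
  assumes "is_ring_hom h"
  shows "h (inv_coord1 j s t u v) = inv_coord1 (h j) (h s) (h t) (h u) (h v)"
    "h (inv_coord2 j s t u v) = inv_coord2 (h j) (h s) (h t) (h u) (h v)"
    "h (inv_coord3 j s t u v) = inv_coord3 (h j) (h s) (h t) (h u) (h v)"
  by (simp_all add: inv_coord1_def inv_coord2_def inv_coord3_def is_ring_hom_simps[OF assms])

text \<open>The polynomial has degree at most 1 in s, so it suffices that it is nonzero. At s = 1, t
  = u = 0 it becomes 2v^3 - (1+i)v, which is where characteristic different from 2 enters.\<close>

lemma Fpoly_not_dvd_inv_coord3:
  fixes i :: "'a::field"
  assumes "(2::'a) \<noteq> 0"
  shows "\<not> Fpoly dvd inv_coord3 (const4 i) var_s var_t var_u var_v"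
proof (rule Fpoly_not_dvd)
  have "\<exists>a b. inv_coord3 (const4 i) var_s var_t var_u var_v = [:a, b:]"
    by (simp add: inv_coord3_def const4_def var_s_def var_t_def var_u_def var_v_def power2_eq_square one_pCons)
  then show "Polynomial.degree (inv_coord3 (const4 i) var_s var_t var_u var_v) < 2"
    by auto
  have hom: "is_ring_hom (\<lambda>p :: 'a mpoly4. eval4 (\<lambda>c. [:c:]) p 1 0 0 [:0, 1:])"
    by (intro is_ring_hom_eval4 is_ring_hom_const_poly)
  have "eval4 (\<lambda>c. [:c:]) (inv_coord3 (const4 i) var_s var_t var_u var_v) 1 0 0 [:0, 1:]
      = [:0, - 1 - i, 0, 2:]"
    unfolding ring_hom_inv_coord(3)[OF hom] eval4_generators[OF is_ring_hom_const_poly]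
    unfolding inv_coord3_def
    by (simp add: power2_eq_square one_pCons)
  also have "\<dots> \<noteq> 0" using assms by simp
  finally show "inv_coord3 (const4 i) var_s var_t var_u var_v \<noteq> 0"
    using is_ring_hom_simps(1)[OF hom] by metis
qed

theorem mainTheorem1:
  fixes i :: "'a::field"
  assumes "(2::'a) \<noteq> 0"
    and "i^2 = -1"
  shows "k_rational_hypersurface (Fpoly :: 'a mpoly4)"
proof -
  obtain s t u v :: "'a ratfun3 alg_closure"
    where gen: "\<And>p. eval4 (\<lambda>c. to_ac (const3 c)) p s t u v = 0 \<longleftrightarrow> Fpoly dvd p"
    using generic_point_exists by blast
  define \<iota> :: "'a \<Rightarrow> 'a ratfun3 alg_closure" where "\<iota> c = to_ac (const3 c)" for c
  have \<iota>: "is_ring_hom \<iota>"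
    unfolding \<iota>_def[abs_def] by (intro is_ring_hom_comp[OF is_ring_hom_const3] is_ring_hom_to_ac)
  have gen: "eval4 \<iota> p s t u v = 0 \<longleftrightarrow> Fpoly dvd p" for p
    using gen by (simp add: \<iota>_def[abs_def])
  note ev\<iota> = is_ring_hom_simps[OF is_ring_hom_eval4[OF \<iota>, of s t u v]]
    eval4_generators[OF \<iota>, where s=s and t=t and u=u and v=v]
  define j where "j = \<iota> i"
  have j: "j^2 = -1"
    using is_ring_hom_simps[OF \<iota>] assms(2) unfolding j_def by metis
  have F: "s^2 * v * (v^2 - 1) - t^2 * u * (u^2 - 1) + u * v * (u^2 - v^2) = 0"
    using gen[of Fpoly] by (simp add: eval4_Fpoly[OF \<iota>])
  have nz: "u \<noteq> 0" "v \<noteq> 0" "u^2 - 1 \<noteq> 0" "v^2 - 1 \<noteq> 0" "u^2 - v^2 \<noteq> 0"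
    using gen[of var_u] gen[of var_v] gen[of "var_u^2 - 1"] gen[of "var_v^2 - 1"]
      gen[of "var_u^2 - var_v^2"]
      Fpoly_not_dvd[of "var_u :: 'a mpoly4"] Fpoly_not_dvd[of "var_v :: 'a mpoly4"]
      Fpoly_not_dvd[of "var_u^2 - 1 :: 'a mpoly4"] Fpoly_not_dvd[of "var_v^2 - 1 :: 'a mpoly4"]
      Fpoly_not_dvd[of "var_u^2 - var_v^2 :: 'a mpoly4"]
    unfolding ev\<iota> by (simp_all add: var_u_def var_v_def power2_eq_square one_pCons)
  have inv3: "inv_coord3 j s t u v \<noteq> 0"
    using Fpoly_not_dvd_inv_coord3[OF assms(1), of i] gen[of "inv_coord3 (const4 i) var_s var_t var_u var_v"]
    unfolding ring_hom_inv_coord[OF is_ring_hom_eval4[OF \<iota>]] ev\<iota> j_def by blast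
  have K: "(u^2-1)*(v^2-1)*(u^2-v^2) \<noteq> 0" using nz by simp
  \<comment> \<open>The image of the generic point under the inverse isomorphism.\<close>
  define y z where "y = v * inv_coord1 j s t u v / inv_coord3 j s t u v"
    and "z = v * inv_coord2 j s t u v / (u * inv_coord3 j s t u v)"
  note inv_map = parametrization_preimage[OF j F inv3 nz(1,2) K, folded y_def z_def]

  \<comment> \<open>Substitutes u, y, z for the three independent variables, innermost first.
    Injectivity of h is not established, so fractions are handled through
    \<open>specializes\<close>.\<close>
  define h where "h = evalp (evalp (evalp \<iota> u) y) z"
  have h: "is_ring_hom h" unfolding h_def by (intro is_ring_hom_evalp \<iota>)
  have h_gen: "h [:[:[:c:]:]:] = \<iota> c" "h [:[:[:0, 1:]:]:] = u" "h [:[:0, 1:]:] = y"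
    "h [:0, 1:] = z" for c
    unfolding h_def
    by (simp_all add: evalp_pCons is_ring_hom_simps[OF \<iota>] is_ring_hom_simps[OF is_ring_hom_evalp[OF \<iota>]]
        is_ring_hom_simps[OF is_ring_hom_evalp[OF is_ring_hom_evalp[OF \<iota>]]])
  define U Y Z J :: "'a ratfun3" where "U = Fract [:[:[:0, 1:]:]:] 1" and "Y = Fract [:[:0, 1:]:] 1"
    and "Z = Fract [:0, 1:] 1" and "J = const3 i"
  \<comment> \<open>V is forced by the equation of the second conic.\<close>
  define V where "V = - (Y^2 + U * Z^2)"
  define L where "L = conic_form1 J U V Y Z"
  define S T where "S = U * conic_form3 J U V Y Z / L" and "T = V * conic_form2 J U V Y Z / L"
  have spc: "specializes h (const3 c) (\<iota> c)" for c
    unfolding const3_def using specializes_Fract_one[OF h] h_gen by metis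
  have spU: "specializes h U u" and spY: "specializes h Y y" and spZ: "specializes h Z z"
    unfolding U_def Y_def Z_def using specializes_Fract_one[OF h] h_gen by metis+
  have spJ: "specializes h J j" unfolding J_def j_def by (rule spc)
  have spV: "specializes h V v"
    unfolding V_def by (subst inv_map(1))
      (intro specializes_uminus specializes_add specializes_mult specializes_power2 h spU spY spZ)
  note spl = specializes_conic_forms[OF h spJ spU spV spY spZ]
  have spS: "specializes h S s"
    unfolding S_def L_def by (subst inv_map(3)) (intro specializes_divide specializes_mult h spU spl inv_map(2))
  have spT: "specializes h T t"
    unfolding T_def L_def by (subst inv_map(4)) (intro specializes_divide specializes_mult h spV spl inv_map(2))
  \<comment> \<open>Nonvanishing in k(x,y,z) is inherited from the specialized values.\<close>
  have L: "L \<noteq> 0" and U: "U \<noteq> 0" and V: "V \<noteq> 0"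
    using specializes_zeroD[OF h] spl(1) spU spV inv_map(2) nz unfolding L_def by metis+
  have "specializes h ((U^2-1)*(V^2-1)*(U^2-V^2)) ((u^2-1)*(v^2-1)*(u^2-v^2))"
    by (intro specializes_mult specializes_diff specializes_power2 specializes_one h spU spV)
  then have KU: "(U^2-1)*(V^2-1)*(U^2-V^2) \<noteq> 0"
    using specializes_zeroD[OF h] K by metis
  have J: "J^2 = -1"
    using is_ring_hom_simps[OF is_ring_hom_const3] assms(2) unfolding J_def by metis
  note forw = parametrization[OF J V_def L[unfolded L_def], folded L_def, folded S_def T_def]

  let ?ev = "\<lambda>p. eval4 const3 p S T U V"
  note hom = is_ring_hom_eval4[OF is_ring_hom_const3, of S T U V]
  note ev = is_ring_hom_simps[OF hom] eval4_generators[OF is_ring_hom_const3, where s=S and t=T and u=U and v=V]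
  have "?ev p = 0 \<longleftrightarrow> Fpoly dvd p" for p
  proof
    assume "?ev p = 0"
    \<comment> \<open>The parametrized point specializes to the generic point, so a polynomial
      vanishing at the former vanishes at the latter.\<close>
    moreover have "specializes h (?ev p) (eval4 \<iota> p s t u v)"
      by (intro specializes_eval4 h spc spS spT spU spV is_ring_hom_simps(1)[OF \<iota>] is_ring_hom_simps(1)[OF is_ring_hom_const3])
    ultimately show "Fpoly dvd p"
      using specializes_zeroD[OF h] gen by metis
  next
    assume "Fpoly dvd p"
    then show "?ev p = 0"
      using forw(1) by (elim dvdE) (simp add: ev(4) eval4_Fpoly[OF is_ring_hom_const3])
  qed
  moreover have "\<exists>p q. ?ev q \<noteq> 0 \<and> w = ?ev p / ?ev q" for w
  proof -
    \<comment> \<open>The subfield generated over k by S, T, U, V. It is all of k(x,y,z) once it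
      contains U, Y and Z.\<close>
    define A where "A = {?ev p / ?ev q | p q. ?ev q \<noteq> 0}"
    have evA: "?ev p \<in> A" for p
      unfolding A_def using ev(2) by (intro CollectI exI[of _ p] exI[of _ 1]) simp
    have add: "a + b \<in> A" and mult: "a * b \<in> A" if "a \<in> A" "b \<in> A" for a b
    proof -
      obtain p q p' q' where *: "a = ?ev p / ?ev q" "?ev q \<noteq> 0" "b = ?ev p' / ?ev q'" "?ev q' \<noteq> 0"
        using \<open>a \<in> A\<close> \<open>b \<in> A\<close> unfolding A_def by blast
      show "a + b \<in> A"
        unfolding A_def using *
        by (intro CollectI exI[of _ "p * q' + p' * q"] exI[of _ "q * q'"]) (simp add: ev add_frac_eq)
      show "a * b \<in> A"
        unfolding A_def using *
        by (intro CollectI exI[of _ "p * p'"] exI[of _ "q * q'"]) (simp add: ev)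
    qed
    have divide: "a / b \<in> A" if "a \<in> A" "b \<in> A" "b \<noteq> 0" for a b
    proof -
      obtain p q where *: "b = ?ev p / ?ev q" "?ev q \<noteq> 0"
        using \<open>b \<in> A\<close> unfolding A_def by blast
      then have "inverse b \<in> A"
        unfolding A_def using \<open>b \<noteq> 0\<close>
        by (intro CollectI exI[of _ q] exI[of _ p]) simp
      then show ?thesis using mult[OF \<open>a \<in> A\<close>] by (simp add: divide_inverse)
    qed
    have cA: "const3 c \<in> A" and UA: "U \<in> A" and VA: "V \<in> A" for c
      using evA[of "const4 c"] evA[of var_u] evA[of var_v] by (simp_all add: ev)
    have mA: "inv_coord1 J S T U V \<in> A" "inv_coord2 J S T U V \<in> A" "inv_coord3 J S T U V \<in> A"
      using evA[of "inv_coord1 (const4 i) var_s var_t var_u var_v"] evA[of "inv_coord2 (const4 i) var_s var_t var_u var_v"]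
        evA[of "inv_coord3 (const4 i) var_s var_t var_u var_v"]
      unfolding ring_hom_inv_coord[OF hom] ev J_def by auto
    have inv3: "inv_coord3 J S T U V \<noteq> 0"
      using forw(4) KU V by auto
    \<comment> \<open>From K x = L w: the ratio of the first and third coordinates of w recovers Y,
      and below the second and third recover Z.\<close>
    have "L * inv_coord3 J S T U V * Y = L * (V * inv_coord1 J S T U V)"
      unfolding forw(4) mult.left_commute[of L V] forw(2) by (simp only: mult_ac)
    then have "Y = V * inv_coord1 J S T U V / inv_coord3 J S T U V"
      using L inv3 by (simp add: field_simps)
    then have YA: "Y \<in> A"
      using divide mult VA mA inv3 by metis
    have "L * inv_coord3 J S T U V * (U * Z) = L * (V * inv_coord2 J S T U V)"
      unfolding forw(4) mult.left_commute[of L V] forw(3) by (simp only: mult_ac)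
    then have "Z = V * inv_coord2 J S T U V / (U * inv_coord3 J S T U V)"
      using L inv3 U by (simp add: field_simps)
    then have ZA: "Z \<in> A"
      using divide[OF mult[OF VA mA(2)] mult[OF UA mA(3)]] inv3 U by simp
    have "0 \<in> A" using evA[of 0] by (simp add: ev)
    note closed = evalp_closed[where A=A, OF _ _ _ this add mult]
    \<comment> \<open>Closure of A under evaluation, applied once per variable in the order U, Y,
      Z.\<close>
    have FractA: "Fract r 1 \<in> A" for r :: "'a poly poly poly"
    proof -
      let ?f = "\<lambda>r :: 'a poly poly poly. Fract r 1"
      have hom1: "is_ring_hom (\<lambda>q. ?f [:q:])" and hom2: "is_ring_hom (\<lambda>q. ?f [:[:q:]:])"
        by (intro is_ring_hom_comp[OF is_ring_hom_const_poly] is_ring_hom_Fract)+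
      have "?f [:[:q:]:] \<in> A" for q
      proof -
        have "evalp const3 U q = ?f [:[:q:]:]"
          using evalp_unique[OF hom2] by (simp add: U_def const3_def[abs_def])
        then show ?thesis using closed[of const3 U q] cA UA is_ring_hom_simps(1)[OF is_ring_hom_const3] by simp
      qed
      then have "?f [:q:] \<in> A" for q
        using closed[of "\<lambda>q. ?f [:[:q:]:]" Y q] YA evalp_unique[OF hom1, of q] is_ring_hom_simps(1)[OF hom2]
        by (simp add: Y_def)
      then show ?thesis
        using closed[of "\<lambda>q. ?f [:q:]" Z r] ZA evalp_unique[OF is_ring_hom_Fract, of r] is_ring_hom_simps(1)[OF hom1]
        by (simp add: Z_def)
    qed
    obtain r d where w: "w = Fract r d" "d \<noteq> 0" by (cases w) auto
    have "Fract d 1 \<noteq> 0" using w(2) by (simp add: Zero_fract_def eq_fract)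
    moreover have "w = Fract r 1 / Fract d 1" using w by simp
    ultimately have "w \<in> A" using divide FractA by metis
    then show ?thesis unfolding A_def by blast
  qed
  ultimately show ?thesis
    unfolding k_rational_hypersurface_def by blast
qed

end
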